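(* Let $g$ be the function defined for all $0<\alpha\le 1$ by $$g(\alpha)=\left(\frac12\gamma-\frac34\right)-\frac12\left(H_{\lfloor\frac1\alpha\rfloor}-\log\frac1\alpha\right)+\left(\log\frac1\alpha\right)\left(-\frac12-\frac12\alpha^2\left\lfloor\frac1\alpha\right\rfloor\left\lfloor\frac1\alpha+1\right\rfloor+\alpha\left\lfloor\frac1\alpha\right\rfloor\right)-\frac14\alpha^2\left\lfloor\frac1\alpha\right\rfloor\left\lfloor\frac1\alpha+1\right\rfloor+\alpha\left\lfloor\frac1\alpha\right\rfloor.$$ It has the following properties: (1) $g$ continuously extends to the domain $[0,1]$, taking the value $g(0)=0$. (2) Let $\tilde g$ be defined for all $0<\alpha\le 1$ by $$\tilde g(\alpha)=-\frac12\psi\left(\frac1\alpha+1\right)+\frac{1-\alpha}{2}\log\frac1\alpha-\frac{\alpha}{4},$$ where $\psi(x)=\frac{\Gamma'}{\Gamma}(x)$ is the digamma function. It is real-analytic on $(0,1]$ and continuously extends to $[0,1]$, taking the value $\tilde g(0)=0$. It interpolates $g$ at reciprocal integer values; i.e., $\tilde g\left(\frac1j\right)=g\left(\frac1j\right)$ for all integers $j\ge 1$. (3) The function $\tilde g(\alpha)$ is strictly convex on $0\le\alpha\le 1$. The function $g(\alpha)$ is strictly concave on each interval $I_j=\left[\frac1{j+1},\frac1j\right]$ for each integer $j\ge 2$. (4) We have $\tilde g(\alpha)\le g(\alpha)$ for all $0\le\alpha\le 1$.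
   Context: $\gamma$ is Euler's constant and $H_m=\sum_{k=1}^m\frac1k$ is the $m$-th harmonic number. In (3) and (4), $g$ and $\tilde g$ denote the continuous extensions to $[0,1]$. *)

theory Defs
  imports "HOL-Analysis.Analysis"
begin

(* g and g_tilde are meant for 0 < \<alpha> \<le> 1 only; their values at 0 are artefacts of 1 / 0 = 0
   and are discarded by extend_at_0 below.  Digamma agrees with Gamma' / Gamma on the positive
   reals by has_field_derivative_Gamma. *)

definition g :: "real \<Rightarrow> real" where
  "g \<alpha> = (1/2 * euler_mascheroni - 3/4)
     - 1/2 * (harm (nat \<lfloor>1/\<alpha>\<rfloor>) - ln (1/\<alpha>))
     + ln (1/\<alpha>) * (- 1/2 - 1/2 * \<alpha>\<^sup>2 * of_int \<lfloor>1/\<alpha>\<rfloor> * of_int \<lfloor>1/\<alpha> + 1\<rfloor> + \<alpha> * of_int \<lfloor>1/\<alpha>\<rfloor>)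
     - 1/4 * \<alpha>\<^sup>2 * of_int \<lfloor>1/\<alpha>\<rfloor> * of_int \<lfloor>1/\<alpha> + 1\<rfloor>
     + \<alpha> * of_int \<lfloor>1/\<alpha>\<rfloor>"

definition g_tilde :: "real \<Rightarrow> real" where
  "g_tilde \<alpha> = - 1/2 * Digamma (1/\<alpha> + 1) + (1 - \<alpha>)/2 * ln (1/\<alpha>) - \<alpha>/4"

(* Lim is unspecified if the limit does not exist; that it exists is part of asserting that
   extend_at_0 f is continuous on {0..1}. *)
definition extend_at_0 :: "(real \<Rightarrow> real) \<Rightarrow> real \<Rightarrow> real" where
  "extend_at_0 f \<alpha> = (if \<alpha> = 0 then Lim (at_right 0) f else f \<alpha>)"

(* S need not be open: f must agree on S with a function that is locally given by convergent
   power series on an open neighbourhood of S. *)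
definition real_analytic_on :: "(real \<Rightarrow> real) \<Rightarrow> real set \<Rightarrow> bool"
    (infixl "real'_analytic'_on" 50) where
  "f real_analytic_on S \<longleftrightarrow>
     (\<exists>U h. open U \<and> S \<subseteq> U \<and>
        (\<forall>x\<in>U. \<exists>F. (\<lambda>t. h (x + t)) has_fps_expansion F) \<and> (\<forall>x\<in>S. h x = f x))"

definition strictly_convex_on :: "real set \<Rightarrow> (real \<Rightarrow> real) \<Rightarrow> bool" where
  "strictly_convex_on S f \<longleftrightarrow> convex S \<and>
     (\<forall>x\<in>S. \<forall>y\<in>S. \<forall>u>0. \<forall>v>0. x \<noteq> y \<longrightarrow> u + v = 1 \<longrightarrow> f (u * x + v * y) < u * f x + v * f y)"

definition strictly_concave_on :: "real set \<Rightarrow> (real \<Rightarrow> real) \<Rightarrow> bool" where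
  "strictly_concave_on S f \<longleftrightarrow> strictly_convex_on S (\<lambda>x. - f x)"

end

theory Submission
  imports Defs "HOL-Complex_Analysis.Complex_Analysis" "HOL-Real_Asymp.Real_Asymp"
begin

text \<open>
  Write $n = \lfloor 1/\alpha \rfloor$.  On $[1/(n+1), 1/n]$ the function \<open>g\<close> is a smooth function
  with derivative $-n \log\alpha\,(1 - (n+1)\alpha)$; the second derivative is negative for
  $n \ge 2$.  With $x = 1/\alpha$, the second derivative of \<open>g_tilde\<close> is
  $-\frac12 x^4 \psi''(x+1) - x^3 \psi'(x+1) + \frac12 x + \frac12 x^2$, and the telescoping bounds
  $\psi'(x+1) \le 1/x$ and $-\psi''(x+1) \ge 2/(2x^2+2x+1)$ make it positive.  Both functions agree
  at reciprocal integers, so between these \<open>g_tilde\<close> lies below and \<open>g\<close> above the common chord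
  for $n \ge 2$.  On $[1/2, 1]$, where \<open>g\<close> is not concave, monotonicity of \<open>g\<close> and a numerical
  bound for $\psi(9/4)$ are used as well.
\<close>

subsection \<open>Strict convexity and continuous extension\<close>

text \<open>The mean value theorem on both sides of an intermediate point \<open>z\<close> gives
  slopes \<open>f' s < f' t\<close> with \<open>s < z < t\<close>. The derivative is demanded in the
  open interval only, so the lemma applies up to the endpoint 0, where
  \<open>extend_at_0 g_tilde\<close> is known only to be continuous.\<close>

lemma strictly_convex_on_interval_deriv:
  fixes f f' :: "real \<Rightarrow> real"
  assumes cont: "continuous_on {a..b} f"
    and deriv: "\<And>x. a < x \<Longrightarrow> x < b \<Longrightarrow> (f has_real_derivative f' x) (at x)"
    and mono: "\<And>x y. a < x \<Longrightarrow> x < y \<Longrightarrow> y < b \<Longrightarrow> f' x < f' y"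
  shows "strictly_convex_on {a..b} f"
proof -
  have less: "f (u * x + v * y) < u * f x + v * f y"
    if xy: "x \<in> {a..b}" "y \<in> {a..b}" "x < y" "u > 0" "v > 0" "u + v = 1" for x y u v
  proof -
    define z where "z = u * x + v * y"
    have u: "u = 1 - v" using that by simp
    have zx: "z - x = v * (y - x)" and yz: "y - z = u * (y - x)"
      by (simp_all add: z_def u algebra_simps)
    have "x < z" "z < y"
      using that zx yz by (metis diff_gt_0_iff_gt mult_pos_pos)+
    have mvt: "\<exists>t. p < t \<and> t < q \<and> f q - f p = (q - p) * f' t"
      if "a \<le> p" "p < q" "q \<le> b" for p q
    proof -
      have "continuous_on {p..q} f"
        by (rule continuous_on_subset[OF cont]) (use that in auto)
      moreover have "f differentiable (at t)" if "p < t" "t < q" for t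
        using deriv[of t] that \<open>a \<le> p\<close> \<open>q \<le> b\<close> by (auto simp: real_differentiable_def)
      ultimately obtain l t where t: "p < t" "t < q" "(f has_real_derivative l) (at t)"
        "f q - f p = (q - p) * l"
        using MVT[of p q f] \<open>p < q\<close> by blast
      then have "l = f' t"
        using deriv[of t] \<open>a \<le> p\<close> \<open>q \<le> b\<close> by (intro DERIV_unique[OF t(3)]) auto
      then show ?thesis using t by blast
    qed
    obtain s where s: "x < s" "s < z" "f z - f x = (z - x) * f' s"
      using mvt[of x z] \<open>x < z\<close> \<open>z < y\<close> xy by auto
    obtain t where t: "z < t" "t < y" "f y - f z = (y - z) * f' t"
      using mvt[of z y] \<open>x < z\<close> \<open>z < y\<close> xy by auto
    have "f' s < f' t"
      using mono[of s t] s t that by auto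
    \<comment> \<open>Since \<open>z - x = v * (y - x)\<close> and
      \<open>y - z = u * (y - x)\<close>, this common factor turns both slopes into weighted
      increments of \<open>f\<close>.\<close>
    then have "(u * v * (y - x)) * f' s < (u * v * (y - x)) * f' t"
      using that by (intro mult_strict_left_mono) auto
    then have "u * (f z - f x) < v * (f y - f z)"
      unfolding s(3) t(3) zx yz by (simp add: ac_simps)
    then have "(u + v) * f z < u * f x + v * f y"
      by (simp add: algebra_simps)
    then show ?thesis using that by (simp add: z_def)
  qed
  show ?thesis
    unfolding strictly_convex_on_def
  proof (intro conjI ballI allI impI)
    fix x y u v :: real
    assume *: "x \<in> {a..b}" "y \<in> {a..b}" "u > 0" "v > 0" "x \<noteq> y" "u + v = 1"
    show "f (u * x + v * y) < u * f x + v * f y"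
    proof (cases "x < y")
      case True
      then show ?thesis using less * by blast
    next
      case False
      then have "f (v * y + u * x) < v * f y + u * f x"
        using less[of y x v u] * by (simp add: add.commute)
      then show ?thesis by (simp add: add.commute)
    qed
  qed simp
qed

lemma strictly_convex_on_interval_deriv2:
  fixes f f' f'' :: "real \<Rightarrow> real"
  assumes cont: "continuous_on {a..b} f"
    and deriv: "\<And>x. a < x \<Longrightarrow> x < b \<Longrightarrow> (f has_real_derivative f' x) (at x)"
    and deriv2: "\<And>x. a < x \<Longrightarrow> x < b \<Longrightarrow> (f' has_real_derivative f'' x) (at x)"
    and pos: "\<And>x. a < x \<Longrightarrow> x < b \<Longrightarrow> f'' x > 0"
  shows "strictly_convex_on {a..b} f"
proof (rule strictly_convex_on_interval_deriv[OF cont deriv])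
  fix x y assume "a < x" "x < y" "y < b"
  then show "f' x < f' y"
    by (intro DERIV_pos_imp_increasing[of x y f'])
      (meson deriv2 pos order_le_less_trans order_less_le_trans)+
qed

lemma strictly_convex_on_imp_le:
  assumes "strictly_convex_on S f" "x \<in> S" "y \<in> S" "u \<ge> 0" "v \<ge> 0" "u + v = 1"
  shows "f (u * x + v * y) \<le> u * f x + v * f y"
proof (cases "u = 0 \<or> v = 0 \<or> x = y")
  case True
  then show ?thesis using assms by (auto simp flip: distrib_right)
next
  case False
  then show ?thesis using assms unfolding strictly_convex_on_def
    by (metis less_eq_real_def)
qed

text \<open>Convexity of \<open>S\<close> keeps every combination \<open>u * x + v * y\<close>
  inside \<open>S\<close>, so values outside \<open>S\<close> never enter.\<close>

lemma strictly_convex_on_cong: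
  assumes "\<And>x. x \<in> S \<Longrightarrow> f x = h x"
  shows "strictly_convex_on S f \<longleftrightarrow> strictly_convex_on S h"
proof -
  have "u * x + v * y \<in> S" if "convex S" "x \<in> S" "y \<in> S" "u > 0" "v > 0" "u + v = 1"
    for x y u v :: real
    using convexD[OF that(1-3), of u v] that by simp
  then show ?thesis
    unfolding strictly_convex_on_def using assms by (smt (verit, best))
qed

lemma strictly_concave_on_cong:
  assumes "\<And>x. x \<in> S \<Longrightarrow> f x = h x"
  shows "strictly_concave_on S f \<longleftrightarrow> strictly_concave_on S h"
  unfolding strictly_concave_on_def using assms by (intro strictly_convex_on_cong) simp

lemma strictly_convex_on_subset:
  assumes "strictly_convex_on S f" "T \<subseteq> S" "convex T"
  shows "strictly_convex_on T f"
  using assms unfolding strictly_convex_on_def by blast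

text \<open>The chords separate the functions: \<open>f\<close> lies below its chord, which lies
  below the chord of \<open>h\<close> by the endpoint values, and \<open>h\<close> lies above its
  own chord.\<close>

lemma convex_le_concave_on_interval:
  assumes f: "strictly_convex_on {a..b} f" and h: "strictly_concave_on {a..b} h"
    and "f a \<le> h a" "f b \<le> h b" "x \<in> {a..b}"
  shows "f x \<le> h x"
proof (cases "a = b")
  case True
  then show ?thesis using assms by auto
next
  case False
  then have "a < b" using assms by auto
  define u where "u = (b - x) / (b - a)"
  define v where "v = (x - a) / (b - a)"
  have uv: "u \<ge> 0" "v \<ge> 0" "u + v = 1"
    using assms \<open>a < b\<close> by (auto simp: u_def v_def diff_divide_distrib[symmetric] add_divide_distrib[symmetric])
  have "u * a + v * b = ((b - x) * a + (x - a) * b) / (b - a)"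
    by (simp add: u_def v_def add_divide_distrib)
  also have "(b - x) * a + (x - a) * b = x * (b - a)"
    by (simp add: algebra_simps)
  finally have x: "u * a + v * b = x" using \<open>a < b\<close> by simp
  have "f x \<le> u * f a + v * f b"
    using strictly_convex_on_imp_le[OF f, of a b u v] uv x \<open>a < b\<close> by simp
  also have "\<dots> \<le> u * h a + v * h b"
    using assms uv by (intro add_mono mult_left_mono)
  also have "\<dots> \<le> h x"
    using strictly_convex_on_imp_le[OF h[unfolded strictly_concave_on_def], of a b u v] uv x \<open>a < b\<close>
    by simp
  finally show ?thesis .
qed

section \<open>Extension by the limit at 0\<close>

text \<open>At 0 continuity is the assumed limit. At \<open>x > 0\<close> it is local, and
  \<open>{x/2..b}\<close> and \<open>{0..b}\<close> coincide near \<open>x\<close>.\<close>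

lemma extend_at_0_continuous:
  fixes f :: "real \<Rightarrow> real"
  assumes lim: "(f \<longlongrightarrow> l) (at_right 0)"
    and cont: "\<And>e. 0 < e \<Longrightarrow> e < b \<Longrightarrow> continuous_on {e..b} f"
  shows "continuous_on {0..b} (extend_at_0 f)" and "extend_at_0 f 0 = l"
proof -
  show l: "extend_at_0 f 0 = l"
    using tendsto_Lim[OF _ lim] by (simp add: extend_at_0_def)
  show "continuous_on {0..b} (extend_at_0 f)"
    unfolding continuous_on_eq_continuous_within
  proof
    fix x assume x: "x \<in> {0..b}"
    show "continuous (at x within {0..b}) (extend_at_0 f)"
    proof (cases "x = 0")
      case True
      have "(extend_at_0 f \<longlongrightarrow> l) (at_right 0)"
        using lim by (rule tendsto_cong[THEN iffD1, rotated])
          (auto simp: extend_at_0_def eventually_at_filter)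
      then have "(extend_at_0 f \<longlongrightarrow> l) (at 0 within {0..b})"
        unfolding at_within_def by (rule filterlim_mono[OF _ order_refl inf_mono]) auto
      then show ?thesis using True l by (simp add: continuous_within)
    next
      case False
      with x have "x > 0" by auto
      define e where "e = x / 2"
      have e: "0 < e" "e < x" "e < b" using \<open>x > 0\<close> x by (auto simp: e_def)
      have "continuous_on {e..b} (extend_at_0 f)"
        using cont[OF e(1,3)] by (rule continuous_on_cong[THEN iffD1, rotated -1])
          (use e in \<open>auto simp: extend_at_0_def\<close>)
      then have "continuous (at x within {e..b}) (extend_at_0 f)"
        using e x by (simp add: continuous_on_eq_continuous_within)
      moreover have "at x within {e..b} = at x within {0..b}"
        using e by (intro at_within_nhd[of _ "{e<..}"]) auto
      ultimately show ?thesis by simp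
    qed
  qed
qed

section \<open>Restricting complex power series to the real line\<close>

text \<open>For real \<open>t\<close> the real part of \<open>c * t ^ n\<close> is
  \<open>Re c * t ^ n\<close>, so taking real parts of the coefficients gives a real series that
  converges at least where the complex one does. This lets complex analyticity yield real
  analyticity of \<open>g_tilde\<close>.\<close>

lemma has_fps_expansion_Re:
  fixes f :: "complex \<Rightarrow> complex"
  assumes "f has_fps_expansion F"
  shows "(\<lambda>t. Re (f (of_real t))) has_fps_expansion Abs_fps (\<lambda>n. Re (fps_nth F n))"
proof -
  let ?R = "Abs_fps (\<lambda>n. Re (fps_nth F n))"
  have sums: "(\<lambda>n. fps_nth ?R n * t ^ n) sums Re (eval_fps F (of_real t))"
    if "ereal \<bar>t\<bar> < fps_conv_radius F" for t
  proof -
    have "(\<lambda>n. fps_nth F n * of_real t ^ n) sums eval_fps F (of_real t)"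
      using that by (intro sums_eval_fps) auto
    from sums_Re[OF this] show ?thesis
      by (simp flip: of_real_power)
  qed
  have radius: "fps_conv_radius ?R \<ge> fps_conv_radius F"
    unfolding fps_conv_radius_def[of ?R]
    by (rule conv_radius_geI_ex') (use sums in \<open>auto simp: sums_iff\<close>)
  have ev: "eventually (\<lambda>z. eval_fps F z = f z) (nhds 0)" and pos: "fps_conv_radius F > 0"
    using assms by (auto simp: has_fps_expansion_def)
  have "filterlim of_real (nhds (0::complex)) (nhds (0::real))"
    using tendsto_of_real[OF filterlim_ident, of "0::real"] by simp
  then have "eventually (\<lambda>t. eval_fps F (of_real t) = f (of_real t)) (nhds (0::real))"
    by (rule eventually_compose_filterlim[OF ev])
  moreover have "eventually (\<lambda>t. t \<in> eball 0 (fps_conv_radius F)) (nhds (0::real))"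
    using pos by (intro eventually_nhds_in_open) (auto simp: zero_ereal_def)
  ultimately have "eventually (\<lambda>t. eval_fps ?R t = Re (f (of_real t))) (nhds (0::real))"
  proof eventually_elim
    case (elim t)
    then have "ereal \<bar>t\<bar> < fps_conv_radius F" by (simp add: eball_def dist_norm)
    from sums[OF this] elim(1) show ?case
      by (simp add: eval_fps_def sums_iff)
  qed
  then show ?thesis
    using radius pos unfolding has_fps_expansion_def by auto
qed

subsection \<open>The interpolating function\<close>

text \<open>Each term of the series satisfies \<open>1 / m^2 <= 1 / (m - 1) - 1 / m\<close> with
  \<open>m = y + k\<close>, and the right-hand sides telescope to
  \<open>1 / (y - 1)\<close>.\<close>

lemma Polygamma_1_le:
  fixes y :: real
  assumes "y > 1"
  shows "Polygamma 1 y \<le> 1 / (y - 1)"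
proof -
  have "filterlim (\<lambda>k. y - 1 + of_nat k) at_infinity sequentially"
    by (intro tendsto_add_filterlim_at_infinity[OF tendsto_const] tendsto_of_nat)
  then have sums1: "(\<lambda>k. inverse (y - 1 + of_nat k) - inverse (y - 1 + of_nat (Suc k)))
      sums (inverse (y - 1 + of_nat 0) - 0)"
    by (intro telescope_sums' filterlim_compose[OF tendsto_inverse_0])
  have sums2: "(\<lambda>k. inverse ((y + of_nat k) ^ 2)) sums Polygamma 1 y"
    using Polygamma_LIMSEQ[of y 1] assms by (simp add: numeral_2_eq_2)
  have "inverse ((y + of_nat k) ^ 2)
      \<le> inverse (y - 1 + of_nat k) - inverse (y - 1 + of_nat (Suc k))" for k
  proof -
    define m where "m = y + of_nat k"
    have "m > 1" using assms by (simp add: m_def)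
    then have "inverse (m ^ 2) \<le> inverse (m - 1) - inverse m"
      by (simp add: field_simps power2_eq_square)
    then show ?thesis by (simp add: m_def algebra_simps)
  qed
  from sums_le[OF this sums2 sums1] have "Polygamma 1 y \<le> inverse (y - 1 + of_nat 0) - 0" .
  then show ?thesis by (simp add: inverse_eq_divide)
qed

text \<open>The telescoping works because $(m^2 - m + 1/2)(m^2 + m + 1/2) = m^4 + 1/4$.\<close>
lemma Polygamma_2_le:
  fixes y :: real
  assumes "y > 0"
  shows "Polygamma 2 y \<le> - 2 / (2 * y\<^sup>2 - 2 * y + 1)"
proof -
  define p where "p m = inverse (2 * m\<^sup>2 - 2 * m + 1)" for m :: real
  have lim: "(\<lambda>k. p (y + of_nat k)) \<longlonglongrightarrow> 0"
    unfolding p_def by real_asymp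
  have sums1: "(\<lambda>k. p (y + of_nat k) - p (y + of_nat (Suc k))) sums (p (y + of_nat 0) - 0)"
    by (rule telescope_sums'[OF lim])
  have sums2: "(\<lambda>k. inverse ((y + of_nat k) ^ 3)) sums (- Polygamma 2 y / 2)"
    using Polygamma_LIMSEQ[of y 2] assms by (simp add: numeral_3_eq_3 numeral_2_eq_2)
  have "p (y + of_nat k) - p (y + of_nat (Suc k)) \<le> inverse ((y + of_nat k) ^ 3)" for k
  proof -
    define m where "m = y + of_nat k"
    have m: "m > 0" using assms by (simp add: m_def)
    have p': "p (m + 1) = inverse (2 * m\<^sup>2 + 2 * m + 1)"
      by (simp add: p_def power2_eq_square algebra_simps)
    \<comment> \<open>A sum of squares shows that the denominator of \<open>p m\<close> is
      positive.\<close>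
    have "2 * m\<^sup>2 - 2 * m + 1 = m\<^sup>2 + (m - 1)\<^sup>2"
      by (simp add: power2_eq_square algebra_simps)
    also have "\<dots> > 0" using m by (intro add_pos_nonneg) auto
    finally have pos: "2 * m\<^sup>2 - 2 * m + 1 > 0" "2 * m\<^sup>2 + 2 * m + 1 > 0"
      using m by (auto simp: add_pos_pos)
    have "p m - p (m + 1) = 4 * m / (4 * m ^ 4 + 1)"
    proof -
      have "p m - p (m + 1) = 4 * m / ((2 * m\<^sup>2 - 2 * m + 1) * (2 * m\<^sup>2 + 2 * m + 1))"
        unfolding p' unfolding p_def using pos by (simp add: inverse_eq_divide diff_frac_eq)
      also have "(2 * m\<^sup>2 - 2 * m + 1) * (2 * m\<^sup>2 + 2 * m + 1) = 4 * m ^ 4 + 1"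
        by (simp add: algebra_simps power2_eq_square power4_eq_xxxx)
      finally show ?thesis .
    qed
    also have "\<dots> \<le> inverse (m ^ 3)"
    proof -
      have "4 * m * m ^ 3 \<le> 4 * m ^ 4 + 1" by (simp add: power_numeral_reduce)
      then show ?thesis using m by (simp add: inverse_eq_divide divide_simps add_pos_pos)
    qed
    finally show ?thesis by (simp add: m_def algebra_simps)
  qed
  from sums_le[OF this sums1 sums2] have "p y \<le> - Polygamma 2 y / 2"
    by simp
  then show ?thesis by (simp add: p_def inverse_eq_divide)
qed

section \<open>First and second derivative of the interpolating function\<close>

definition g_tilde' :: "real \<Rightarrow> real" where
  "g_tilde' \<alpha> = Polygamma 1 (1/\<alpha> + 1) / (2 * \<alpha>\<^sup>2) + ln \<alpha> / 2 - (1 - \<alpha>) / (2 * \<alpha>) - 1/4"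

definition g_tilde'' :: "real \<Rightarrow> real" where
  "g_tilde'' \<alpha> = - Polygamma 2 (1/\<alpha> + 1) / (2 * \<alpha> ^ 4) - Polygamma 1 (1/\<alpha> + 1) / \<alpha> ^ 3
     + 1 / (2 * \<alpha>) + 1 / (2 * \<alpha>\<^sup>2)"

lemma not_nonpos_Int_pos: "(x::real) > 0 \<Longrightarrow> x \<notin> \<int>\<^sub>\<le>\<^sub>0"
  by (auto elim!: nonpos_Ints_cases)

lemma has_real_derivative_g_tilde:
  assumes "\<alpha> > 0"
  shows "(g_tilde has_real_derivative g_tilde' \<alpha>) (at \<alpha>)"
proof -
  have "1/\<alpha> + 1 \<notin> \<int>\<^sub>\<le>\<^sub>0"
    using assms by (intro not_nonpos_Int_pos) (simp add: add_pos_pos)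
  then have "((\<lambda>\<alpha>. - 1/2 * Digamma (1/\<alpha> + 1) - (1 - \<alpha>)/2 * ln \<alpha> - \<alpha>/4)
      has_real_derivative g_tilde' \<alpha>) (at \<alpha>)"
    unfolding g_tilde'_def using assms
    by (auto intro!: derivative_eq_intros) (simp add: field_simps power2_eq_square)
  moreover have "\<forall>\<^sub>F x in nhds \<alpha>. g_tilde x = - 1/2 * Digamma (1/x + 1) - (1 - x)/2 * ln x - x/4"
    using eventually_nhds_in_open[of "{0<..}" \<alpha>] assms
    by (auto elim!: eventually_mono simp: g_tilde_def ln_div)
  ultimately show ?thesis by (simp add: DERIV_cong_ev)
qed

lemma has_real_derivative_g_tilde':
  assumes "\<alpha> > 0"
  shows "(g_tilde' has_real_derivative g_tilde'' \<alpha>) (at \<alpha>)"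
proof -
  have "1/\<alpha> + 1 \<notin> \<int>\<^sub>\<le>\<^sub>0"
    using assms by (intro not_nonpos_Int_pos) (simp add: add_pos_pos)
  then show ?thesis
    unfolding g_tilde'_def[abs_def] g_tilde''_def using assms
    by (auto intro!: derivative_eq_intros simp: numeral_2_eq_2 simp del: One_nat_def)
      (simp add: field_simps power_numeral_reduce)
qed

text \<open>After both polygamma bounds are inserted, the quartic and cubic terms of the common
  numerator cancel, and exactly \<open>x * (x + 1) / (2 * (2 * x^2 + 2 * x + 1))\<close>
  remains.\<close>

lemma g_tilde''_pos:
  assumes "\<alpha> > 0"
  shows "g_tilde'' \<alpha> > 0"
proof -
  define x where "x = 1 / \<alpha>"
  have x: "x > 0" using assms by (simp add: x_def)
  have "\<alpha> = 1 / x" by (simp add: x_def)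
  then have eq: "g_tilde'' \<alpha> = - Polygamma 2 (x + 1) * x ^ 4 / 2 - Polygamma 1 (x + 1) * x ^ 3
      + x / 2 + x\<^sup>2 / 2"
    by (simp add: g_tilde''_def power_one_over field_simps)
  have D: "2 * x\<^sup>2 + 2 * x + 1 > 0" using x by (simp add: add_pos_pos)
  have "Polygamma 2 (x + 1) \<le> - 2 / (2 * x\<^sup>2 + 2 * x + 1)"
    using Polygamma_2_le[of "x + 1"] x by (simp add: power2_eq_square algebra_simps)
  then have "Polygamma 2 (x + 1) * (x ^ 4 / 2) \<le> - 2 / (2 * x\<^sup>2 + 2 * x + 1) * (x ^ 4 / 2)"
    using x by (intro mult_right_mono) auto
  \<comment> \<open>A variable in place of the quadratic keeps the denominator atomic during
    simplification.\<close>
  moreover have "- 2 / d * (x ^ 4 / 2) = - (x ^ 4 / d)" for d :: real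
    by simp
  note this[of "2 * x\<^sup>2 + 2 * x + 1"]
  moreover have "Polygamma 1 (x + 1) * x ^ 3 \<le> 1 / x * x ^ 3"
    using Polygamma_1_le[of "x + 1"] x by (intro mult_right_mono) auto
  moreover have "1 / x * x ^ 3 = x\<^sup>2"
    using x by (simp add: power_numeral_reduce)
  moreover have "x ^ 4 / (2 * x\<^sup>2 + 2 * x + 1) - x\<^sup>2 + x / 2 + x\<^sup>2 / 2
      = x * (x + 1) / (2 * (2 * x\<^sup>2 + 2 * x + 1))"
    using D by (simp add: field_simps power_numeral_reduce)
  moreover have "x * (x + 1) / (2 * (2 * x\<^sup>2 + 2 * x + 1)) > 0"
    using x D by simp
  ultimately show ?thesis unfolding eq by linarith
qed

section \<open>Asymptotics of harmonic numbers and the digamma function\<close>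

lemma filterlim_nat_floor: "filterlim (\<lambda>x::real. nat \<lfloor>x\<rfloor>) sequentially at_top"
  by (intro filterlim_compose[OF filterlim_nat_sequentially] filterlim_floor_sequentially)

text \<open>The limit along integers defining Euler's constant carries over to real
  \<open>x\<close>: replacing the logarithm of the floor by \<open>ln x\<close> costs between 0 and
  \<open>ln x - ln (x - 1)\<close>, which vanishes in the limit.\<close>

lemma harm_nat_floor_minus_ln:
  "((\<lambda>x::real. harm (nat \<lfloor>x\<rfloor>) - ln x) \<longlongrightarrow> euler_mascheroni) at_top"
proof -
  have "((\<lambda>x::real. harm (nat \<lfloor>x\<rfloor>) - ln (real (nat \<lfloor>x\<rfloor>))) \<longlongrightarrow> euler_mascheroni) at_top"
    by (rule filterlim_compose[OF euler_mascheroni_LIMSEQ filterlim_nat_floor])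
  moreover have "((\<lambda>x::real. ln x - ln (real (nat \<lfloor>x\<rfloor>))) \<longlongrightarrow> 0) at_top"
  proof (rule tendsto_sandwich[of "\<lambda>_. 0" _ _ "\<lambda>x. ln x - ln (x - 1)"])
    show "((\<lambda>x::real. ln x - ln (x - 1)) \<longlongrightarrow> 0) at_top" by real_asymp
    have n: "x - 1 < real (nat \<lfloor>x\<rfloor>)" "real (nat \<lfloor>x\<rfloor>) \<le> x" if "x > 1" for x :: real
      using that by linarith+
    show "\<forall>\<^sub>F x::real in at_top. 0 \<le> ln x - ln (real (nat \<lfloor>x\<rfloor>))"
      using eventually_gt_at_top[of 1] by eventually_elim (use n in force)
    show "\<forall>\<^sub>F x::real in at_top. ln x - ln (real (nat \<lfloor>x\<rfloor>)) \<le> ln x - ln (x - 1)"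
      using eventually_gt_at_top[of 1] by eventually_elim (use n in force)
  qed auto
  ultimately have "((\<lambda>x::real. (harm (nat \<lfloor>x\<rfloor>) - ln (real (nat \<lfloor>x\<rfloor>)))
      - (ln x - ln (real (nat \<lfloor>x\<rfloor>)))) \<longlongrightarrow> euler_mascheroni - 0) at_top"
    by (rule tendsto_diff)
  then show ?thesis by simp
qed

text \<open>Digamma increases on the positive reals and equals
  \<open>harm n - euler_mascheroni\<close> at \<open>n + 1\<close>. With \<open>n\<close> the floor
  of \<open>x\<close>, this encloses \<open>Digamma (x + 1)\<close> between values at consecutive
  integers, which differ by \<open>1 / (n + 1) <= 1 / x\<close>.\<close>

lemma Digamma_minus_ln: "((\<lambda>x::real. Digamma (x + 1) - ln x) \<longlongrightarrow> 0) at_top"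
proof -
  have "((\<lambda>x::real. Digamma (x + 1) + euler_mascheroni - harm (nat \<lfloor>x\<rfloor>)) \<longlongrightarrow> 0) at_top"
  proof (rule tendsto_sandwich[of "\<lambda>_. 0" _ _ "\<lambda>x. 1 / x"])
    show "((\<lambda>x::real. 1 / x) \<longlongrightarrow> 0) at_top" by real_asymp
    have *: "0 \<le> Digamma (x + 1) + euler_mascheroni - harm (nat \<lfloor>x\<rfloor>) \<and>
        Digamma (x + 1) + euler_mascheroni - harm (nat \<lfloor>x\<rfloor>) \<le> 1 / x" if "x > 1" for x :: real
    proof -
      define n where "n = nat \<lfloor>x\<rfloor>"
      have n: "real n \<le> x" "x < real n + 1" using that by (auto simp: n_def)
      have "Digamma (of_nat (Suc n)) \<le> Digamma (x + 1)"
        using n by (intro Digamma_real_mono) auto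
      moreover have "Digamma (x + 1) \<le> Digamma (of_nat (Suc (Suc n)))"
        using n that by (intro Digamma_real_mono) auto
      moreover have "harm (Suc n) = harm n + 1 / (real n + 1)"
        by (simp add: harm_Suc field_simps)
      moreover have "1 / (real n + 1) \<le> 1 / x"
        using n that by (intro divide_left_mono) auto
      ultimately show ?thesis
        unfolding Digamma_of_nat n_def[symmetric] by simp
    qed
    show "\<forall>\<^sub>F x::real in at_top. 0 \<le> Digamma (x + 1) + euler_mascheroni - harm (nat \<lfloor>x\<rfloor>)"
      "\<forall>\<^sub>F x::real in at_top. Digamma (x + 1) + euler_mascheroni - harm (nat \<lfloor>x\<rfloor>) \<le> 1 / x"
      by (rule eventually_mono[OF eventually_gt_at_top[of 1]], use * in blast)+
  qed auto
  from tendsto_diff[OF tendsto_add[OF this harm_nat_floor_minus_ln] tendsto_const[of euler_mascheroni]]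
  show ?thesis by simp
qed

lemma g_tilde_tendsto_0: "(g_tilde \<longlongrightarrow> 0) (at_right 0)"
proof -
  have "filterlim (\<lambda>\<alpha>::real. 1 / \<alpha>) at_top (at_right 0)" by real_asymp
  from filterlim_compose[OF Digamma_minus_ln this]
  have 1: "((\<lambda>\<alpha>::real. Digamma (1/\<alpha> + 1) - ln (1/\<alpha>)) \<longlongrightarrow> 0) (at_right 0)" .
  have 2: "((\<lambda>\<alpha>::real. \<alpha>/2 * ln (1/\<alpha>) + \<alpha>/4) \<longlongrightarrow> 0) (at_right 0)" by real_asymp
  \<comment> \<open>Half of the logarithm is paired with the digamma term; each of the two groups
    then tends to 0.\<close>
  have "g_tilde = (\<lambda>\<alpha>. -1/2 * (Digamma (1/\<alpha> + 1) - ln (1/\<alpha>)) - (\<alpha>/2 * ln (1/\<alpha>) + \<alpha>/4))"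
    by (rule ext) (simp add: g_tilde_def field_simps)
  with tendsto_diff[OF tendsto_mult_left[OF 1, of "-1/2"] 2] show ?thesis
    by simp
qed

section \<open>Real analyticity of the interpolating function\<close>

text \<open>On positive reals the arguments of \<open>Ln\<close> and \<open>Digamma\<close> avoid
  the branch cut and the poles, so the complex counterpart \<open>G\<close> is analytic there. It
  takes the real values \<open>g_tilde\<close>, and the real part of its power series is the
  required expansion.\<close>

lemma g_tilde_real_analytic: "g_tilde real_analytic_on {0<..1}"
  unfolding real_analytic_on_def
proof (rule exI[of _ "{0<..}"], rule exI[of _ g_tilde], intro conjI ballI)
  define G :: "complex \<Rightarrow> complex" where
    "G z = - 1/2 * Digamma (1/z + 1) + (1 - z)/2 * Ln (1/z) - z/4" for z
  fix x :: real assume "x \<in> {0<..}"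
  then have x: "x > 0" by simp
  have "1 / complex_of_real x \<notin> \<real>\<^sub>\<le>\<^sub>0"
  proof -
    have "1 / complex_of_real x = of_real (1 / x)" by simp
    then show ?thesis using x by (simp only: nonpos_Reals_of_real_iff) simp
  qed
  moreover have "1 / complex_of_real x + 1 \<notin> \<int>\<^sub>\<le>\<^sub>0"
  proof -
    have "1 / complex_of_real x + 1 = of_real (1 / x + 1)" by simp
    then show ?thesis using not_nonpos_Int_pos[of "1/x + 1"] x
      by (simp only: of_real_in_nonpos_Ints_iff) (simp add: add_pos_pos)
  qed
  ultimately have "G analytic_on {of_real x}"
    unfolding G_def using x by (intro analytic_intros) auto
  then have "(\<lambda>t. G (of_real x + t)) has_fps_expansion fps_expansion G (of_real x)"
    by (rule analytic_at_imp_has_fps_expansion)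
  from has_fps_expansion_Re[OF this]
  have "(\<lambda>t. Re (G (of_real x + of_real t))) has_fps_expansion
      Abs_fps (\<lambda>n. Re (fps_nth (fps_expansion G (of_real x)) n))" .
  moreover have "\<forall>\<^sub>F t in nhds 0. Re (G (of_real x + of_real t)) = g_tilde (x + t)"
  proof -
    have "\<forall>\<^sub>F t in nhds (0::real). t \<in> {-x<..}"
      using x by (intro eventually_nhds_in_open) auto
    then show ?thesis
    proof eventually_elim
      case (elim t)
      define y where "y = x + t"
      have y: "y > 0" using elim by (simp add: y_def)
      have "Digamma (1 / complex_of_real y + 1) = of_real (Digamma (1 / y + 1))"
        using y by (subst Polygamma_of_real[symmetric]) (simp_all add: add_pos_pos less_imp_neq[THEN not_sym])
      moreover have "Ln (1 / complex_of_real y) = of_real (ln (1 / y))"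
        using y by (subst Ln_of_real[symmetric]) simp_all
      ultimately have "G (of_real y) = of_real (g_tilde y)"
        by (simp add: G_def g_tilde_def)
      then show ?case by (simp add: y_def)
    qed
  qed
  ultimately show "\<exists>F. (\<lambda>t. g_tilde (x + t)) has_fps_expansion F"
    by (auto simp: has_fps_expansion_cong cong: has_fps_expansion_cong)
qed auto

subsection \<open>The branches of \<open>g\<close>\<close>

lemma nat_floor_le: "x \<ge> 0 \<Longrightarrow> real (nat \<lfloor>x\<rfloor>) \<le> x" for x :: real
  by (rule of_nat_floor)

lemma less_nat_floor_add_1: "x < real (nat \<lfloor>x\<rfloor>) + 1" for x :: real
  by linarith

lemma pos_if_recip_le:
  assumes "1 / (real n + 1) \<le> x"
  shows "0 < x"
proof -
  have "0 < 1 / (real n + 1)" by simp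
  then show ?thesis using assms by (rule less_le_trans)
qed

text \<open>The formula for \<open>g\<close> with the floor of \<open>1/\<alpha>\<close> frozen at
  \<open>n\<close>. The two terms with half the logarithm, one beside the harmonic number and one in
  the bracket, have cancelled.\<close>

definition g_branch :: "nat \<Rightarrow> real \<Rightarrow> real" where
  "g_branch n \<alpha> = euler_mascheroni / 2 - 3/4 - harm n / 2
     - ln \<alpha> * (real n * \<alpha> - real n * (real n + 1) / 2 * \<alpha>\<^sup>2)
     - real n * (real n + 1) / 4 * \<alpha>\<^sup>2 + real n * \<alpha>"

lemma g_eq_g_branch_floor:
  assumes "\<alpha> > 0"
  shows "g \<alpha> = g_branch (nat \<lfloor>1/\<alpha>\<rfloor>) \<alpha>"
proof -
  have "real_of_int \<lfloor>1/\<alpha>\<rfloor> = real (nat \<lfloor>1/\<alpha>\<rfloor>)" using assms by simp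
  then show ?thesis
    unfolding g_def g_branch_def using assms
    by (simp add: ln_div) (simp add: field_simps)
qed

lemma g_eq_g_branch_aux:
  assumes "n \<ge> 1" "1 / (real n + 1) < \<alpha>" "\<alpha> \<le> 1 / real n"
  shows "g \<alpha> = g_branch n \<alpha>"
proof -
  have pos: "\<alpha> > 0" by (rule le_less_trans[OF _ assms(2)]) simp
  have "real n \<le> 1 / \<alpha>" "1 / \<alpha> < real n + 1"
    using assms pos by (simp_all add: field_simps)
  then have "\<lfloor>1/\<alpha>\<rfloor> = int n" by (intro floor_unique) auto
  with g_eq_g_branch_floor[OF pos] show ?thesis by simp
qed

text \<open>At \<open>1 / m\<close> with \<open>m = n + 1\<close> both branches have the same
  coefficient of the logarithm; the harmonic numbers contribute \<open>- 1 / (2 * m)\<close> to the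
  difference and the polynomial terms \<open>1 / (2 * m)\<close>.\<close>

lemma g_branch_Suc:
  "g_branch (Suc n) (1 / (real n + 1)) = g_branch n (1 / (real n + 1))"
proof -
  define m where "m = real n + 1"
  have m: "m > 0" "real n = m - 1" "real (Suc n) = m" by (simp_all add: m_def)
  have h: "harm (Suc n) = harm n + 1 / m"
    by (simp add: harm_Suc m_def inverse_eq_divide add.commute)
  show ?thesis
    unfolding g_branch_def m_def[symmetric] m(3) unfolding m(2)
    using m(1) by (simp add: h field_simps power2_eq_square)
qed

text \<open>At the left endpoint the floor of \<open>1/\<alpha>\<close> is already
  \<open>n + 1\<close>, so \<open>g\<close> is on the next branch there; the two branches agree at
  that point.\<close>

lemma g_eq_g_branch:
  assumes "n \<ge> 1" "\<alpha> \<in> {1 / (real n + 1)..1 / real n}"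
  shows "g \<alpha> = g_branch n \<alpha>"
proof (cases "\<alpha> = 1 / (real n + 1)")
  case True
  have "g \<alpha> = g_branch (Suc n) \<alpha>"
  proof (rule g_eq_g_branch_aux)
    show "1 / (real (Suc n) + 1) < \<alpha>"
      unfolding True by (intro divide_strict_left_mono) auto
  qed (use True in \<open>simp_all add: add.commute\<close>)
  then show ?thesis using True g_branch_Suc by simp
next
  case False
  then show ?thesis using assms by (intro g_eq_g_branch_aux) auto
qed

section \<open>Derivative and concavity of the branches\<close>

lemma has_real_derivative_g_branch:
  assumes "\<alpha> > 0"
  shows "(g_branch n has_real_derivative - real n * ln \<alpha> * (1 - (real n + 1) * \<alpha>)) (at \<alpha>)"
  unfolding g_branch_def[abs_def] using assms
  by (auto intro!: derivative_eq_intros) (simp add: field_simps power2_eq_square)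

lemma continuous_on_g_branch: "S \<subseteq> {0<..} \<Longrightarrow> continuous_on S (g_branch n)"
  by (meson DERIV_isCont continuous_at_imp_continuous_on greaterThan_iff
      has_real_derivative_g_branch subset_iff)

text \<open>The logarithmic hypothesis says that the second derivative is negative. The interval is
  left free because the branch \<open>n = 1\<close> is concave only on part of its domain.\<close>

lemma g_branch_strictly_concave:
  assumes "n \<ge> 1" "a > 0"
    and ln: "\<And>\<alpha>. a < \<alpha> \<Longrightarrow> \<alpha> < b \<Longrightarrow> 1 / \<alpha> - (real n + 1) * ln \<alpha> > real n + 1"
  shows "strictly_concave_on {a..b} (g_branch n)"
  unfolding strictly_concave_on_def
proof (rule strictly_convex_on_interval_deriv2[where
      f' = "\<lambda>\<alpha>. real n * ln \<alpha> * (1 - (real n + 1) * \<alpha>)" and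
      f'' = "\<lambda>\<alpha>. real n * (1 / \<alpha> - (real n + 1) * ln \<alpha> - (real n + 1))"])
  show "continuous_on {a..b} (\<lambda>x. - g_branch n x)"
    using assms by (intro continuous_intros continuous_on_g_branch) auto
next
  fix x assume x: "a < x" "x < b"
  then have "x > 0" using assms by simp
  from DERIV_minus[OF has_real_derivative_g_branch[OF this, of n]]
  show "((\<lambda>x. - g_branch n x) has_real_derivative real n * ln x * (1 - (real n + 1) * x)) (at x)"
    by simp
  show "((\<lambda>\<alpha>. real n * ln \<alpha> * (1 - (real n + 1) * \<alpha>)) has_real_derivative
      real n * (1 / x - (real n + 1) * ln x - (real n + 1))) (at x)"
    using \<open>x > 0\<close> by (auto intro!: derivative_eq_intros) (simp add: field_simps)
  show "real n * (1 / x - (real n + 1) * ln x - (real n + 1)) > 0"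
    using ln[OF x] assms by simp
qed

lemma g_strictly_concave:
  assumes "n \<ge> 2"
  shows "strictly_concave_on {1 / (real n + 1)..1 / real n} g"
proof -
  have "strictly_concave_on {1 / (real n + 1)..1 / real n} (g_branch n)"
  proof (rule g_branch_strictly_concave)
    fix \<alpha> assume \<alpha>: "1 / (real n + 1) < \<alpha>" "\<alpha> < 1 / real n"
    have "\<alpha> > 0" by (rule le_less_trans[OF _ \<alpha>(1)]) simp
    have n: "real n < 1 / \<alpha>" using \<alpha> \<open>\<alpha> > 0\<close> assms by (simp add: field_simps)
    \<comment> \<open>Since \<open>1/\<alpha>\<close> exceeds \<open>n\<close>, it suffices that
      \<open>(n + 1) * ln (1/\<alpha>)\<close> is at least 1; for \<open>n >= 2\<close> this bound
      makes it at least 2.\<close>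
    have "2 / 3 \<le> ln (1 / \<alpha>)"
    proof -
      have "2 \<le> 1 / \<alpha>" using n assms by linarith
      then have "ln 2 \<le> ln (1 / \<alpha>)"
        using \<open>\<alpha> > 0\<close> by (subst ln_le_cancel_iff) auto
      then show ?thesis using ln2_ge_two_thirds by linarith
    qed
    then have "3 * (2 / 3) \<le> (real n + 1) * ln (1 / \<alpha>)"
      using assms by (intro mult_mono) auto
    then show "1 / \<alpha> - (real n + 1) * ln \<alpha> > real n + 1"
      using n \<open>\<alpha> > 0\<close> by (simp add: ln_div)
  qed (use assms in auto)
  then show ?thesis
    using g_eq_g_branch[of n] assms by (subst strictly_concave_on_cong[where h = "g_branch n"]) auto
qed

section \<open>Continuity of g and its limit at 0\<close>

text \<open>Induction glues one more closed branch interval at its common endpoint with the previous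
  ones, starting from the single point 1.\<close>

lemma continuous_on_g_aux: "continuous_on {1 / (real n + 1)..1} g"
proof (induction n)
  case 0
  then show ?case by simp
next
  case (Suc n)
  let ?I = "{1 / (real (Suc n) + 1)..1 / real (Suc n)}"
  have "?I \<subseteq> {0<..}"
    by (intro subsetI) (metis atLeastAtMost_iff greaterThan_iff pos_if_recip_le)
  then have "continuous_on ?I (g_branch (Suc n))"
    by (rule continuous_on_g_branch)
  then have "continuous_on ?I g"
    by (subst continuous_on_cong[OF refl g_eq_g_branch[of "Suc n"]]) auto
  with Suc have "continuous_on ({1 / (real (Suc n) + 1)..1 / (real n + 1)} \<union> {1 / (real n + 1)..1}) g"
    by (intro continuous_on_closed_Un) (auto simp: add.commute)
  also have "{1 / (real (Suc n) + 1)..1 / (real n + 1)} \<union> {1 / (real n + 1)..1} = {1 / (real (Suc n) + 1)..1}"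
    by (intro ivl_disj_un_two_touch(4)) (auto simp: field_simps)
  finally show ?case .
qed

lemma continuous_on_g:
  assumes "e > 0"
  shows "continuous_on {e..1} g"
proof -
  obtain n where "1 / (real n + 1) < e"
    using nat_approx_posE[OF assms] by (metis add.commute of_nat_Suc)
  then show ?thesis
    by (intro continuous_on_subset[OF continuous_on_g_aux[of n]]) auto
qed

lemma g_tendsto_0: "(g \<longlongrightarrow> 0) (at_right 0)"
proof -
  define n where "n \<alpha> = real (nat \<lfloor>1/\<alpha>\<rfloor>)" for \<alpha> :: real
  have bounds: "1 - \<alpha> \<le> n \<alpha> * \<alpha>" "n \<alpha> * \<alpha> \<le> 1" if "\<alpha> > 0" for \<alpha>
  proof -
    have "1 / \<alpha> - 1 \<le> n \<alpha>" "n \<alpha> \<le> 1 / \<alpha>"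
      using that nat_floor_le[of "1/\<alpha>"] less_nat_floor_add_1[of "1/\<alpha>"] unfolding n_def by simp_all
    then show "1 - \<alpha> \<le> n \<alpha> * \<alpha>" "n \<alpha> * \<alpha> \<le> 1" using that by (simp_all add: field_simps)
  qed
  have ev: "\<forall>\<^sub>F \<alpha>::real in at_right 0. 0 < \<alpha> \<and> \<alpha> < 1"
    using eventually_at_right_less[of "0::real"] eventually_at_right_real[of 0 "1::real"]
    by (auto elim: eventually_mono)
  have r: "((\<lambda>\<alpha>. n \<alpha> * \<alpha>) \<longlongrightarrow> 1) (at_right 0)"
  proof (rule tendsto_sandwich[of "\<lambda>\<alpha>. 1 - \<alpha>" _ _ "\<lambda>_. 1"])
    show "((\<lambda>\<alpha>::real. 1 - \<alpha>) \<longlongrightarrow> 1) (at_right 0)" by real_asymp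
  qed (auto intro!: eventually_mono[OF ev] bounds)
  \<comment> \<open>Completing the square in \<open>n \<alpha> * \<alpha>\<close> shows that the
    coefficient of the logarithm lies between 0 and \<open>\<alpha>\<close>, which is small enough
    to absorb \<open>ln \<alpha>\<close>.\<close>
  have L: "((\<lambda>\<alpha>. ln \<alpha> * ((1 - n \<alpha> * \<alpha>)\<^sup>2 / 2 + n \<alpha> * \<alpha> * \<alpha> / 2)) \<longlongrightarrow> 0) (at_right 0)"
  proof (rule tendsto_sandwich[of "\<lambda>\<alpha>. ln \<alpha> * \<alpha>" _ _ "\<lambda>_. 0"])
    show "((\<lambda>\<alpha>::real. ln \<alpha> * \<alpha>) \<longlongrightarrow> 0) (at_right 0)" by real_asymp
    have *: "0 \<le> (1 - n \<alpha> * \<alpha>)\<^sup>2 / 2 + n \<alpha> * \<alpha> * \<alpha> / 2 \<and>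
        (1 - n \<alpha> * \<alpha>)\<^sup>2 / 2 + n \<alpha> * \<alpha> * \<alpha> / 2 \<le> \<alpha> \<and> ln \<alpha> < 0" if "0 < \<alpha> \<and> \<alpha> < 1" for \<alpha>
    proof -
      have "(1 - n \<alpha> * \<alpha>)\<^sup>2 \<le> \<alpha> * 1"
        unfolding power2_eq_square using bounds[of \<alpha>] that by (intro mult_mono) auto
      moreover have "n \<alpha> * \<alpha> * \<alpha> \<le> 1 * \<alpha>"
        using bounds[of \<alpha>] that by (intro mult_right_mono) auto
      moreover have "n \<alpha> * \<alpha> * \<alpha> \<ge> 0"
        using that by (simp add: n_def)
      moreover have "(1 - n \<alpha> * \<alpha>)\<^sup>2 \<ge> 0" "ln \<alpha> < 0" using that by simp_all
      ultimately show ?thesis by linarith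
    qed
    show "\<forall>\<^sub>F \<alpha> in at_right 0. ln \<alpha> * \<alpha> \<le> ln \<alpha> * ((1 - n \<alpha> * \<alpha>)\<^sup>2 / 2 + n \<alpha> * \<alpha> * \<alpha> / 2)"
      by (rule eventually_mono[OF ev], rule mult_left_mono_neg) (use * in \<open>auto intro: less_imp_le\<close>)
    show "\<forall>\<^sub>F \<alpha> in at_right 0. ln \<alpha> * ((1 - n \<alpha> * \<alpha>)\<^sup>2 / 2 + n \<alpha> * \<alpha> * \<alpha> / 2) \<le> 0"
      by (rule eventually_mono[OF ev], rule mult_nonpos_nonneg) (use * in \<open>auto intro: less_imp_le\<close>)
  qed auto
  have H: "((\<lambda>\<alpha>::real. harm (nat \<lfloor>1/\<alpha>\<rfloor>) - ln (1/\<alpha>)) \<longlongrightarrow> euler_mascheroni) (at_right 0)"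
  proof -
    have "filterlim (\<lambda>\<alpha>::real. 1 / \<alpha>) at_top (at_right 0)" by real_asymp
    from filterlim_compose[OF harm_nat_floor_minus_ln this] show ?thesis .
  qed
  \<comment> \<open>In the limit Euler's constant cancels, and so do the rationals:
    \<open>- 3/4 - 1/4 + 1 = 0\<close>.\<close>
  have "((\<lambda>\<alpha>. euler_mascheroni / 2 - 3/4 - (harm (nat \<lfloor>1/\<alpha>\<rfloor>) - ln (1/\<alpha>)) / 2
      + ln \<alpha> * ((1 - n \<alpha> * \<alpha>)\<^sup>2 / 2 + n \<alpha> * \<alpha> * \<alpha> / 2)
      - (n \<alpha> * \<alpha>)\<^sup>2 / 4 - n \<alpha> * \<alpha> * \<alpha> / 4 + n \<alpha> * \<alpha>)
    \<longlongrightarrow> euler_mascheroni / 2 - 3/4 - euler_mascheroni / 2 + 0 - 1\<^sup>2 / 4 - 1 * 0 / 4 + 1) (at_right 0)"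
    by (intro tendsto_intros H L r) auto
  then have "((\<lambda>\<alpha>. euler_mascheroni / 2 - 3/4 - (harm (nat \<lfloor>1/\<alpha>\<rfloor>) - ln (1/\<alpha>)) / 2
      + ln \<alpha> * ((1 - n \<alpha> * \<alpha>)\<^sup>2 / 2 + n \<alpha> * \<alpha> * \<alpha> / 2)
      - (n \<alpha> * \<alpha>)\<^sup>2 / 4 - n \<alpha> * \<alpha> * \<alpha> / 4 + n \<alpha> * \<alpha>) \<longlongrightarrow> 0) (at_right 0)"
    by simp
  then show ?thesis
  proof (rule tendsto_cong[THEN iffD1, rotated], intro eventually_mono[OF ev])
    fix \<alpha> :: real assume "0 < \<alpha> \<and> \<alpha> < 1"
    then show "euler_mascheroni / 2 - 3/4 - (harm (nat \<lfloor>1/\<alpha>\<rfloor>) - ln (1/\<alpha>)) / 2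
      + ln \<alpha> * ((1 - n \<alpha> * \<alpha>)\<^sup>2 / 2 + n \<alpha> * \<alpha> * \<alpha> / 2)
      - (n \<alpha> * \<alpha>)\<^sup>2 / 4 - n \<alpha> * \<alpha> * \<alpha> / 4 + n \<alpha> * \<alpha> = g \<alpha>"
      by (simp add: g_eq_g_branch_floor g_branch_def n_def[symmetric] ln_div)
        (simp add: field_simps power2_eq_square)
  qed
qed

section \<open>Comparison of g_tilde and g\<close>

text \<open>Digamma at \<open>j + 1\<close> is \<open>harm j - euler_mascheroni\<close>, and at
  \<open>1 / j\<close> the logarithm in branch \<open>j\<close> has coefficient
  \<open>(1 - 1 / j) / 2\<close> up to sign, as in \<open>g_tilde\<close>.\<close>

lemma g_tilde_eq_g:
  assumes "j \<ge> 1"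
  shows "g_tilde (1 / real j) = g (1 / real j)"
proof -
  have "Digamma (real j + 1) = harm j - euler_mascheroni"
    using Digamma_of_nat[of j, where ?'a = real] by (simp add: add.commute)
  moreover have "g (1 / real j) = g_branch j (1 / real j)"
    using assms by (intro g_eq_g_branch) (auto simp: field_simps)
  ultimately show ?thesis
    using assms by (simp add: g_tilde_def g_branch_def ln_div power2_eq_square) (simp add: field_simps)
qed

lemma g_tilde_strictly_convex: "strictly_convex_on {0..1} (extend_at_0 g_tilde)"
proof (rule strictly_convex_on_interval_deriv2[where f' = g_tilde' and f'' = g_tilde''])
  show "continuous_on {0..1} (extend_at_0 g_tilde)"
    by (intro extend_at_0_continuous(1)[OF g_tilde_tendsto_0] continuous_at_imp_continuous_on)
      (auto intro!: DERIV_isCont[OF has_real_derivative_g_tilde])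
next
  fix x :: real assume x: "0 < x" "x < 1"
  have "\<forall>\<^sub>F y in nhds x. extend_at_0 g_tilde y = g_tilde y"
  proof (rule eventually_mono)
    show "\<forall>\<^sub>F y in nhds x. y \<in> {0<..}"
      using x by (intro eventually_nhds_in_open) auto
  qed (auto simp: extend_at_0_def)
  then show "(extend_at_0 g_tilde has_real_derivative g_tilde' x) (at x)"
    using has_real_derivative_g_tilde[of x] x by (simp add: DERIV_cong_ev)
qed (auto intro: has_real_derivative_g_tilde' g_tilde''_pos)

lemma g_tilde_strictly_convex_pos:
  assumes "a > 0" "b \<le> 1"
  shows "strictly_convex_on {a..b} g_tilde"
proof -
  have "strictly_convex_on {a..b} (extend_at_0 g_tilde)"
    using assms by (intro strictly_convex_on_subset[OF g_tilde_strictly_convex]) auto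
  then show ?thesis
    using assms by (subst strictly_convex_on_cong[where h = "extend_at_0 g_tilde"])
      (auto simp: extend_at_0_def)
qed

text \<open>The shift from $9/4$ to $17/4$ is needed: concavity of the digamma function gives
  $\psi(17/4) \ge (\psi(4) + \psi(9/2))/2$ with known values on the right-hand side, whereas the
  same bound at $9/4$ itself would be too weak.\<close>
lemma g_tilde_four_fifths_le: "g_tilde (4/5) \<le> euler_mascheroni / 2 - 3/4"
proof -
  have "strictly_convex_on {4..9/2} (\<lambda>x::real. - Digamma x)"
  proof (rule strictly_convex_on_interval_deriv)
    show "continuous_on {4..9/2} (\<lambda>x::real. - Digamma x)"
      by (intro continuous_on_minus continuous_on_Polygamma) (auto elim!: nonpos_Ints_cases)
    show "((\<lambda>x. - Digamma x) has_real_derivative - Polygamma 1 x) (at x)" if "4 < x" for x :: real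
      using that by (auto intro!: derivative_eq_intros not_nonpos_Int_pos)
    show "- Polygamma 1 x < - Polygamma 1 y" if "4 < x" "x < y" for x y :: real
      using that Polygamma_real_strict_antimono[of x y 1] by simp
  qed
  from strictly_convex_on_imp_le[OF this, of 4 "9/2" "1/2" "1/2"]
  have "Digamma (17/4 :: real) \<ge> (Digamma 4 + Digamma (9/2)) / 2"
    by simp
  moreover have "Digamma (4 :: real) = 11/6 - euler_mascheroni"
    by (simp add: Digamma_numeral harm_expand)
  moreover have "Digamma (9/2 :: real) = 352/105 - 2 * ln 2 - euler_mascheroni"
    using Digamma_half_integer[of 4, where ?'a = real]
    by (simp add: eval_nat_numeral)
  moreover have "Digamma (17/4 :: real) = Digamma (9/4) + 4/9 + 4/13"
    using Digamma_plus1[of "9/4 :: real"] Digamma_plus1[of "13/4 :: real"] by simp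
  \<comment> \<open>The trapezoidal rule for the convex function \<open>1/t\<close> on
    \<open>[1, 5/4]\<close>.\<close>
  moreover have "ln (5/4 :: real) \<le> 9/40"
    using ln_inverse_approx_le[of 1 "1/4"] by simp
  \<comment> \<open>At \<open>\<alpha> = 4/5\<close> the digamma argument is \<open>9/4\<close>. The
    collected bounds leave a margin below \<open>1/1000\<close>.\<close>
  ultimately show ?thesis
    using ln2_le_25_over_36 by (simp add: g_tilde_def)
qed

text \<open>Near 1 the function \<open>g\<close> is convex, so the comparison of a convex with a concave function only
  works on $[1/2, 18/25]$.  On the rest \<open>g\<close> is decreasing, and it suffices to compare the maximum
  of the convex \<open>g_tilde\<close> at the end points of $[18/25, 4/5]$ and $[4/5, 1]$ with the value of \<open>g\<close>
  at the right end point.\<close>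
lemma g_tilde_le_g_first:
  assumes "\<alpha> \<in> {1/2..1}"
  shows "g_tilde \<alpha> \<le> g \<alpha>"
proof -
  have g1: "g \<alpha> = g_branch 1 \<alpha>" if "\<alpha> \<in> {1/2..1}" for \<alpha>
    using g_eq_g_branch[of 1 \<alpha>] that by simp
  have conv: "strictly_convex_on {1/2..1} g_tilde"
    by (rule g_tilde_strictly_convex_pos) auto
  have anti: "g_branch 1 y \<le> g_branch 1 x" if "1/2 \<le> x" "x \<le> y" "y \<le> 1" for x y
  proof (rule DERIV_nonpos_imp_nonincreasing[OF that(2)])
    fix z assume "x \<le> z" "z \<le> y"
    then have "z > 0" "ln z * (1 - 2 * z) \<ge> 0"
      using that by (auto intro!: mult_nonpos_nonpos)
    then show "\<exists>d. (g_branch 1 has_real_derivative d) (at z) \<and> d \<le> 0"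
      using has_real_derivative_g_branch[of z 1] by (intro exI conjI) auto
  qed
  have end1: "g_tilde 1 = g_branch 1 1"
    using g_tilde_eq_g[of 1] g1[of 1] by simp
  have end2: "g_tilde (1/2) = g_branch 1 (1/2)"
    using g_tilde_eq_g[of 2] g1[of "1/2"] by simp
  have one: "g_branch 1 1 = euler_mascheroni / 2 - 3/4"
    by (simp add: g_branch_def harm_expand)
  have half: "g_branch 1 (1/2) = euler_mascheroni / 2 - 7/8 + ln 2 / 4"
    by (simp add: g_branch_def harm_expand ln_div power2_eq_square)
  \<comment> \<open>The midpoint rule for the convex function \<open>1/t\<close> on
    \<open>[1, x]\<close>.\<close>
  have ln: "2 * (x - 1) / (x + 1) \<le> ln x" if "x > 1" for x :: real
    using ln_inverse_approx_ge[of 1 x] that by (simp add: add.commute)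
  \<comment> \<open>The exact value is
    \<open>euler_mascheroni / 2 - 77/100 + 4/25 * ln (5/4)\<close>, and \<open>ln (5/4)\<close> is
    at least \<open>2/9\<close>.\<close>
  have low: "euler_mascheroni / 2 - 77/100 + 8/225 \<le> g_branch 1 (4/5)"
  proof -
    have "2 / 9 \<le> ln (5/4 :: real)" using ln[of "5/4"] by simp
    moreover have "ln (4/5 :: real) = - ln (5/4)" by (simp add: ln_div)
    ultimately show ?thesis by (simp add: g_branch_def harm_expand power2_eq_square)
  qed
  have tilde_45: "g_tilde (4/5) \<le> g_branch 1 1"
    using g_tilde_four_fifths_le one by simp
  \<comment> \<open>The weights express \<open>18/25\<close> as a convex combination of
    \<open>1/2\<close> and \<open>4/5\<close>.\<close>
  have "g_tilde (18/25) \<le> 4/15 * g_tilde (1/2) + 11/15 * g_tilde (4/5)"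
    using strictly_convex_on_imp_le[OF conv, of "1/2" "4/5" "4/15" "11/15"] by simp
  also have "\<dots> \<le> 4/15 * (euler_mascheroni / 2 - 7/8 + ln 2 / 4) + 11/15 * (euler_mascheroni / 2 - 3/4)"
    using tilde_45 unfolding end2 half one by (intro add_left_mono mult_left_mono) auto
  also have "\<dots> = euler_mascheroni / 2 - 47/60 + ln 2 / 15"
    by (simp add: field_simps)
  also have "\<dots> \<le> g_branch 1 (4/5)"
    using low ln2_le_25_over_36 by linarith
  finally have tilde_1825: "g_tilde (18/25) \<le> g_branch 1 (4/5)" .
  have between: "g_tilde x \<le> c" if "x \<in> {a..b}" "a \<ge> 1/2" "b \<le> 1" "g_tilde a \<le> c" "g_tilde b \<le> c" for a b c x
  proof -
    have "x \<in> closed_segment a b" using that by (simp add: closed_segment_eq_real_ivl)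
    then obtain u where u: "0 \<le> u" "u \<le> 1" "x = (1 - u) * a + u * b"
      by (auto simp: closed_segment_def)
    have "g_tilde x \<le> (1 - u) * g_tilde a + u * g_tilde b"
      unfolding u(3) using that u by (intro strictly_convex_on_imp_le[OF conv]) auto
    also have "\<dots> \<le> (1 - u) * c + u * c"
      using that u by (intro add_mono mult_left_mono) auto
    finally show ?thesis by (simp add: algebra_simps)
  qed
  consider "\<alpha> \<in> {1/2..18/25}" | "\<alpha> \<in> {18/25..4/5}" | "\<alpha> \<in> {4/5..1}"
    using assms by fastforce
  then show ?thesis
  proof cases
    case 1
    have "strictly_concave_on {1/2..18/25} (g_branch 1)"
    proof (rule g_branch_strictly_concave)
      fix x :: real assume x: "1/2 < x" "x < 18/25"
      define y where "y = 1 / x"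
      have y: "y > 25/18" using x by (simp add: y_def field_simps)
      \<comment> \<open>With the lower bound for \<open>ln y\<close>, concavity reduces to
        \<open>y * (y + 3) > 6\<close>. The left-hand side here is just above 6, which is why the
        interval stops at \<open>18/25\<close>.\<close>
      have "25/18 * (25/18 + 3) < y * (y + 3)" using y by (intro mult_strict_mono) auto
      then have "(2 - y) * (y + 1) < 4 * (y - 1)" by (simp add: algebra_simps)
      then have "2 - y < 2 * (2 * (y - 1) / (y + 1))" using y by (simp add: field_simps)
      also have "\<dots> \<le> 2 * ln y" using y by (intro mult_left_mono ln) auto
      finally show "1 / x - (real 1 + 1) * ln x > real 1 + 1"
        using x by (simp add: y_def ln_div)
    qed auto
    moreover have "g_tilde (18/25) \<le> g_branch 1 (18/25)"
      using tilde_1825 anti[of "18/25" "4/5"] by simp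
    ultimately have "g_tilde \<alpha> \<le> g_branch 1 \<alpha>"
      using 1 end2 g_tilde_strictly_convex_pos[of "1/2" "18/25"]
        convex_le_concave_on_interval[of "1/2" "18/25" g_tilde "g_branch 1" \<alpha>] by simp
    then show ?thesis using g1[OF assms] by simp
  next
    case 2
    have "g_tilde \<alpha> \<le> g_branch 1 (4/5)"
      using tilde_45 anti[of "4/5" 1] tilde_1825 by (intro between[OF 2]) auto
    then show ?thesis using g1[OF assms] anti[of \<alpha> "4/5"] 2 by simp
  next
    case 3
    have "g_tilde \<alpha> \<le> g_branch 1 1"
      using tilde_45 end1 by (intro between[OF 3]) auto
    then show ?thesis using g1[OF assms] anti[of \<alpha> 1] 3 by simp
  qed
qed

lemma g_tilde_le_g:
  assumes "0 < \<alpha>" "\<alpha> \<le> 1"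
  shows "g_tilde \<alpha> \<le> g \<alpha>"
proof -
  define n where "n = nat \<lfloor>1/\<alpha>\<rfloor>"
  have "real n \<le> 1 / \<alpha>" "1 / \<alpha> < real n + 1"
    using assms nat_floor_le[of "1/\<alpha>"] less_nat_floor_add_1[of "1/\<alpha>"] unfolding n_def by simp_all
  moreover have "n \<ge> 1" using assms by (simp add: n_def le_nat_iff)
  ultimately have \<alpha>: "\<alpha> \<in> {1 / (real n + 1)..1 / real n}"
    using assms by (auto simp: field_simps)
  show ?thesis
  proof (cases "n = 1")
    case True
    then show ?thesis using \<alpha> by (intro g_tilde_le_g_first) simp
  next
    case False
    with \<open>n \<ge> 1\<close> have "n \<ge> 2" by simp
    show ?thesis
    proof (rule convex_le_concave_on_interval[OF _ g_strictly_concave[OF \<open>n \<ge> 2\<close>] _ _ \<alpha>])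
      show "strictly_convex_on {1 / (real n + 1)..1 / real n} g_tilde"
        using \<open>n \<ge> 1\<close> by (intro g_tilde_strictly_convex_pos) (auto simp: field_simps)
      show "g_tilde (1 / real n) \<le> g (1 / real n)"
        using g_tilde_eq_g[of n] \<open>n \<ge> 1\<close> by simp
      show "g_tilde (1 / (real n + 1)) \<le> g (1 / (real n + 1))"
        using g_tilde_eq_g[of "Suc n"] by (simp add: add.commute)
    qed
  qed
qed

theorem lemma9p2:
  shows
    "(continuous_on {0..1} (extend_at_0 g) \<and> extend_at_0 g 0 = 0) \<and>
     (g_tilde real_analytic_on {0<..1} \<and>
      continuous_on {0..1} (extend_at_0 g_tilde) \<and> extend_at_0 g_tilde 0 = 0 \<and>
      (\<forall>j::nat. j \<ge> 1 \<longrightarrow> g_tilde (1 / real j) = g (1 / real j))) \<and>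
     (strictly_convex_on {0..1} (extend_at_0 g_tilde) \<and>
      (\<forall>j::nat. j \<ge> 2 \<longrightarrow>
         strictly_concave_on {1 / (real j + 1)..1 / real j} (extend_at_0 g))) \<and>
     (\<forall>\<alpha>\<in>{0..1}. extend_at_0 g_tilde \<alpha> \<le> extend_at_0 g \<alpha>)"
proof (intro conjI allI ballI impI)
  show "continuous_on {0..1} (extend_at_0 g)" "extend_at_0 g 0 = 0"
    using extend_at_0_continuous[OF g_tendsto_0] continuous_on_g by auto
  show g_tilde_0: "continuous_on {0..1} (extend_at_0 g_tilde)" "extend_at_0 g_tilde 0 = 0"
    by (rule extend_at_0_continuous[OF g_tilde_tendsto_0];
        auto intro!: continuous_at_imp_continuous_on DERIV_isCont[OF has_real_derivative_g_tilde])+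
  show "strictly_concave_on {1 / (real j + 1)..1 / real j} (extend_at_0 g)" if "j \<ge> 2" for j
  proof -
    \<comment> \<open>The interval stays away from 0, so the extension changes nothing on
      it.\<close>
    have "extend_at_0 g x = g x" if "x \<in> {1 / (real j + 1)..1 / real j}" for x
    proof -
      have "0 < 1 / (real j + 1)" by simp
      also have "\<dots> \<le> x" using that by simp
      finally show ?thesis by (simp add: extend_at_0_def)
    qed
    then show ?thesis
      using g_strictly_concave[OF that] strictly_concave_on_cong by blast
  qed
  fix \<alpha> :: real assume "\<alpha> \<in> {0..1}"
  then show "extend_at_0 g_tilde \<alpha> \<le> extend_at_0 g \<alpha>"
    using g_tilde_0(2) extend_at_0_continuous(2)[OF g_tendsto_0, of 1] continuous_on_g g_tilde_le_g[of \<alpha>]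
    by (cases "\<alpha> = 0") (auto simp: extend_at_0_def)
qed (auto intro: g_tilde_real_analytic g_tilde_eq_g g_tilde_strictly_convex)

end
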